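(* Let $n,m\ge 1$ and $0\le t<T$ be integers, let $\sigma:\mathbb{R}\to\mathbb{R}$ be a function applied coordinatewise to vectors, let $\mathbf{W}_k\in\mathbb{R}^{n\times n}$ be orthogonal matrices and $\mathbf{V}_k\in\mathbb{R}^{n\times m}$ arbitrary matrices for $k=t,\dots,T-1$, let $x_{t+1},\dots,x_T\in\mathbb{R}^m$ be fixed inputs, and let $h_t\in\mathbb{R}^n$. Define, for $k=t,\dots,T-1$, $$z_{k+1}=\mathbf{W}_k h_k+\mathbf{V}_k x_{k+1},\qquad h_{k+1}=\sigma(z_{k+1}),$$ and assume that $\sigma$ is differentiable at every coordinate $z_{k+1}^{(j)}$ ($t\le k\le T-1$, $1\le j\le n$). Let $C:\mathbb{R}^n\to\mathbb{R}$ be an objective, viewed as a function of $h_T$, that is differentiable at $h_T$. Put $\mathbf{D}_{k+1}=\mathrm{diag}\big(\sigma'(z_{k+1}^{(1)}),\dots,\sigma'(z_{k+1}^{(n)})\big)$. Then $$\left\|\frac{\partial C}{\partial h_t}\right\|\le\left\|\frac{\partial C}{\partial h_T}\right\|\prod_{k=t}^{T-1}\|\mathbf{D}_{k+1}\|.$$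
   Context: The norm of a vector is the Euclidean ($L_2$) norm and the norm of a matrix is the operator norm induced by it. A real square matrix $\mathbf{W}$ is orthogonal if $\mathbf{W}^\top\mathbf{W}=\mathbf{W}\mathbf{W}^\top=\mathbf{I}$. $\frac{\partial C}{\partial h_T}$ is the gradient of $C$ at $h_T$, and $\frac{\partial C}{\partial h_t}$ is the gradient, at the given $h_t$, of the composite map sending $h_t$ to $C(h_T)$ through the recursion, with all $\mathbf{W}_k,\mathbf{V}_k,x_{k+1}$ held fixed. *)

theory Defs
  imports "HOL-Analysis.Analysis"
begin

definition coordwise :: "(real \<Rightarrow> real) \<Rightarrow> real^'n \<Rightarrow> real^'n" where
  "coordwise \<sigma> v = (\<chi> j. \<sigma> (v $ j))"

definition diag_matrix :: "real^'n \<Rightarrow> real^'n^'n" where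
  "diag_matrix d = (\<chi> i j. if i = j then d $ i else 0)"

(* Meaningful only where f is differentiable; there the representing vector is unique. *)
definition gradient :: "('a::real_inner \<Rightarrow> real) \<Rightarrow> 'a \<Rightarrow> 'a" where
  "gradient f p = (THE g. GDERIV f p :> g)"

(* The hidden state at time k as a function of the hidden state a at time t.
   For k \<le> t the value is a, so that the recursion effectively starts at time t. *)
primrec hidden_state ::
  "(real \<Rightarrow> real) \<Rightarrow> (nat \<Rightarrow> real^'n^'n) \<Rightarrow> (nat \<Rightarrow> real^'m^'n) \<Rightarrow> (nat \<Rightarrow> real^'m)
    \<Rightarrow> nat \<Rightarrow> real^'n \<Rightarrow> nat \<Rightarrow> real^'n" where
  "hidden_state \<sigma> W V x t a 0 = a"
| "hidden_state \<sigma> W V x t a (Suc k) =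
    (if k < t then a
     else coordwise \<sigma> (W k *v hidden_state \<sigma> W V x t a k + V k *v x (Suc k)))"

end

(* By the chain rule the derivative of the state at time T with respect to the state at time t is
   D_T W_{T-1} ... D_{t+1} W_t.  Each orthogonal factor is an isometry, so submultiplicativity
   leaves only the norms of the D_k; and the norm of a gradient is the operator norm of the
   derivative it represents. *)
theory Submission
  imports Defs
begin

text \<open>Cauchy-Schwarz gives the upper bound, and it is attained at \<open>g\<close>
  itself.\<close>

lemma onorm_inner_eq_norm:
  fixes g :: "'a::real_inner"
  shows "onorm (\<lambda>v. v \<bullet> g) = norm g"
proof (rule antisym)
  show "onorm (\<lambda>v. v \<bullet> g) \<le> norm g"
  proof (rule onorm_bound)
    show "norm (v \<bullet> g) \<le> norm g * norm v" for v
      using Cauchy_Schwarz_ineq2[of v g] by (simp add: mult.commute)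
  qed simp
  \<comment> \<open>Evaluation at \<open>v = g\<close>; the common factor \<open>norm g\<close>
    cancels unless \<open>g = 0\<close>, where nonnegativity of \<open>onorm\<close>
    suffices.\<close>
  have "norm g * norm g \<le> onorm (\<lambda>v. v \<bullet> g) * norm g"
    using onorm[OF bounded_linear_inner_left, of g g]
    by (simp add: power2_norm_eq_inner flip: power2_eq_square)
  then show "norm g \<le> onorm (\<lambda>v. v \<bullet> g)"
    by (cases "g = 0") (auto simp: onorm_pos_le bounded_linear_inner_left)
qed

text \<open>Riesz representation turns gradients into derivatives, so that the chain rule and
  submultiplicativity of \<open>onorm\<close> become applicable.\<close>

lemma norm_gradient_eq_onorm:
  fixes f :: "'a::euclidean_space \<Rightarrow> real"
  assumes f: "(f has_derivative f') (at p)"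
  shows "norm (gradient f p) = onorm f'"
proof -
  \<comment> \<open>The Riesz vector of \<open>f'\<close>: its coordinates are the values of
    \<open>f'\<close> on the basis.\<close>
  define g where "g = (\<Sum>b\<in>Basis. f' b *\<^sub>R b)"
  have "linear f'"
    using f has_derivative_linear by blast
  have f'_eq: "f' = (\<lambda>v. v \<bullet> g)"
  proof
    fix v
    have "f' v = f' (\<Sum>b\<in>Basis. (v \<bullet> b) *\<^sub>R b)"
      by (simp add: euclidean_representation)
    also have "\<dots> = v \<bullet> g"
      using \<open>linear f'\<close>
      by (simp add: g_def linear_sum linear_scale inner_sum_right mult.commute)
    finally show "f' v = v \<bullet> g" .
  qed
  have "gradient f p = g"
    unfolding gradient_def
  proof (rule the_equality)
    show "GDERIV f p :> g"
      using f by (simp add: gderiv_def f'_eq)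
  next
    \<comment> \<open>Since \<open>gradient\<close> is a definite description, uniqueness is needed
      too; it comes from uniqueness of the derivative.\<close>
    fix g' assume "GDERIV f p :> g'"
    then have "(\<lambda>v. v \<bullet> g') = f'"
      using f has_derivative_unique by (auto simp: gderiv_def)
    then show "g' = g"
      unfolding f'_eq by (metis inner_commute vector_eq_ldot)
  qed
  then show ?thesis
    by (simp add: f'_eq onorm_inner_eq_norm)
qed

text \<open>Output \<open>j\<close> depends on input \<open>j\<close> alone, so the Jacobian is
  diagonal, and differentiability of \<sigma> at the coordinates of \<open>v\<close> is
  enough.\<close>

lemma has_derivative_coordwise:
  fixes v :: "real^'n"
  assumes "\<And>j. \<sigma> differentiable (at (v $ j))"
  shows "(coordwise \<sigma> has_derivative (*v) (diag_matrix (\<chi> j. deriv \<sigma> (v $ j)))) (at v)"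
proof -
  have mult: "(diag_matrix (\<chi> j. deriv \<sigma> (v $ j)) *v u) $ j = deriv \<sigma> (v $ j) * u $ j" for u j
    by (simp add: diag_matrix_def matrix_vector_mult_def if_distrib[of "\<lambda>c. c * _"] cong: if_cong)
  have "((\<lambda>u. \<sigma> (u $ j)) has_derivative (\<lambda>u. deriv \<sigma> (v $ j) * u $ j)) (at v)" for j
  proof -
    have "(\<sigma> has_real_derivative deriv \<sigma> (v $ j)) (at (v $ j))"
      using assms[of j] by (simp add: DERIV_deriv_iff_real_differentiable)
    then have "(\<sigma> has_derivative (*) (deriv \<sigma> (v $ j))) (at (v $ j))"
      by (simp add: has_field_derivative_def)
    moreover have "((\<lambda>u. u $ j) has_derivative (\<lambda>u. u $ j)) (at v)"
      by (intro bounded_linear_imp_has_derivative bounded_linear_vec_nth)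
    ultimately show ?thesis
      using has_derivative_compose by blast
  qed
  then show ?thesis
    by (subst has_derivative_componentwise_within)
       (auto simp: Basis_vec_def inner_axis coordwise_def mult)
qed

lemma norm_orthogonal_matrix_mult:
  fixes W :: "real^'n^'n"
  assumes "orthogonal_matrix W"
  shows "norm (W *v u) = norm u"
  using assms by (simp add: orthogonal_transformation_norm orthogonal_transformation_matrix)

lemma onorm_orthogonal_matrix_le:
  fixes W :: "real^'n^'n"
  assumes "orthogonal_matrix W"
  shows "onorm ((*v) W) \<le> 1"
  by (rule onorm_bound) (simp_all add: norm_orthogonal_matrix_mult[OF assms])

lemma hidden_state_start: "hidden_state \<sigma> W V x t a t = a"
  by (cases t) auto

text \<open>Induction on \<open>T\<close>. The equation for the state is carried along because it
  locates the point at which the next layer is differentiated; of the derivative itself only a norm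
  bound is kept.\<close>

lemma hidden_state_has_derivative:
  fixes W :: "nat \<Rightarrow> real^'n^'n" and h z :: "nat \<Rightarrow> real^'n"
  assumes "t \<le> T"
    and W: "\<And>k. t \<le> k \<Longrightarrow> k < T \<Longrightarrow> orthogonal_matrix (W k)"
    and z: "\<And>k. t \<le> k \<Longrightarrow> k < T \<Longrightarrow> z (Suc k) = W k *v h k + V k *v x (Suc k)"
    and h: "\<And>k. t \<le> k \<Longrightarrow> k < T \<Longrightarrow> h (Suc k) = coordwise \<sigma> (z (Suc k))"
    and \<sigma>: "\<And>k j. t \<le> k \<Longrightarrow> k < T \<Longrightarrow> \<sigma> differentiable (at (z (Suc k) $ j))"
  shows "hidden_state \<sigma> W V x t (h t) T = h T \<and>
    (\<exists>L. ((\<lambda>a. hidden_state \<sigma> W V x t a T) has_derivative L) (at (h t)) \<and>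
      onorm L \<le> (\<Prod>k=t..<T. onorm ((*v) (diag_matrix (\<chi> j. deriv \<sigma> (z (Suc k) $ j))))))"
  using assms
proof (induction T rule: dec_induct)
  case base
  show ?case
    \<comment> \<open>The map is the identity, of norm at most 1, which is the value of the empty
      product.\<close>
    by (auto simp: hidden_state_start intro!: exI[of _ "\<lambda>a. a"] onorm_id_le)
next
  case (step k)
  let ?s = "\<lambda>a. hidden_state \<sigma> W V x t a k"
  let ?D = "\<lambda>k. diag_matrix (\<chi> j. deriv \<sigma> (z (Suc k) $ j))"
  from step obtain L where s: "?s (h t) = h k"
    and L: "(?s has_derivative L) (at (h t))"
    and le: "onorm L \<le> (\<Prod>k=t..<k. onorm ((*v) (?D k)))"
    by auto
  let ?aff = "\<lambda>a. W k *v ?s a + V k *v x (Suc k)"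
  \<comment> \<open>This is the point where \<sigma> is assumed differentiable in each
    coordinate.\<close>
  have aff: "?aff (h t) = z (Suc k)"
    using step s by simp
  have bl: "bounded_linear L"
    using L by (rule has_derivative_bounded_linear)
  \<comment> \<open>The input term does not depend on \<open>a\<close>, so it contributes
    nothing.\<close>
  have "(?aff has_derivative (\<lambda>u. W k *v L u)) (at (h t))"
    using bounded_linear.has_derivative[OF matrix_vector_mul_bounded_linear L, of "W k"]
    by (auto intro!: derivative_eq_intros)
  moreover have "(coordwise \<sigma> has_derivative (*v) (?D k)) (at (?aff (h t)))"
    unfolding aff using step by (intro has_derivative_coordwise) simp
  ultimately have deriv:
    "((\<lambda>a. coordwise \<sigma> (?aff a)) has_derivative (\<lambda>u. ?D k *v (W k *v L u))) (at (h t))"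
    by (rule has_derivative_compose)
  have "onorm (\<lambda>u. W k *v L u) \<le> onorm ((*v) (W k)) * onorm L"
    using onorm_compose[OF matrix_vector_mul_bounded_linear bl] by (simp add: o_def)
  \<comment> \<open>Orthogonality enters here: the factor \<open>W k\<close> costs nothing in the
    bound.\<close>
  also have "\<dots> \<le> 1 * onorm L"
    using step by (intro mult_right_mono onorm_orthogonal_matrix_le onorm_pos_le bl) simp
  finally have WL: "onorm (\<lambda>u. W k *v L u) \<le> onorm L"
    by simp
  have "onorm (\<lambda>u. ?D k *v (W k *v L u)) \<le> onorm ((*v) (?D k)) * onorm (\<lambda>u. W k *v L u)"
    using onorm_compose[OF matrix_vector_mul_bounded_linear
        bounded_linear_compose[OF matrix_vector_mul_bounded_linear bl]] by (simp add: o_def)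
  also have "\<dots> \<le> onorm ((*v) (?D k)) * (\<Prod>k=t..<k. onorm ((*v) (?D k)))"
    using WL le by (intro mult_left_mono onorm_pos_le matrix_vector_mul_bounded_linear) linarith
  also have "\<dots> = (\<Prod>k=t..<Suc k. onorm ((*v) (?D k)))"
    using step by (simp add: mult.commute)
  finally show ?case
    using deriv aff step by auto
qed

text \<open>The differentiability conjunct certifies that the gradient on the left of the inequality
  is a genuine one.\<close>

theorem mainTheorem1:
  fixes \<sigma> :: "real \<Rightarrow> real"
    and W :: "nat \<Rightarrow> real^'n^'n"
    and V :: "nat \<Rightarrow> real^'m^'n"
    and x :: "nat \<Rightarrow> real^'m"
    and h z :: "nat \<Rightarrow> real^'n"
    and C :: "real^'n \<Rightarrow> real"
    and t T :: nat
  assumes "t < T"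
    and "\<And>k. t \<le> k \<Longrightarrow> k < T \<Longrightarrow> orthogonal_matrix (W k)"
    and "\<And>k. t \<le> k \<Longrightarrow> k < T \<Longrightarrow> z (Suc k) = W k *v h k + V k *v x (Suc k)"
    and "\<And>k. t \<le> k \<Longrightarrow> k < T \<Longrightarrow> h (Suc k) = coordwise \<sigma> (z (Suc k))"
    and "\<And>k j. t \<le> k \<Longrightarrow> k < T \<Longrightarrow> \<sigma> differentiable (at (z (Suc k) $ j))"
    and "C differentiable (at (h T))"
  shows "(\<lambda>a. C (hidden_state \<sigma> W V x t a T)) differentiable (at (h t)) \<and>
    norm (gradient (\<lambda>a. C (hidden_state \<sigma> W V x t a T)) (h t))
      \<le> norm (gradient C (h T)) *
        (\<Prod>k=t..<T. onorm ((*v) (diag_matrix (\<chi> j. deriv \<sigma> (z (Suc k) $ j)))))"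
proof -
  let ?s = "\<lambda>a. hidden_state \<sigma> W V x t a T"
  let ?P = "\<Prod>k=t..<T. onorm ((*v) (diag_matrix (\<chi> j. deriv \<sigma> (z (Suc k) $ j))))"
  obtain L where s: "?s (h t) = h T" and L: "(?s has_derivative L) (at (h t))"
    and le: "onorm L \<le> ?P"
    using hidden_state_has_derivative[of t T W z h V x \<sigma>] assms(1-5) by auto
  obtain C' where C': "(C has_derivative C') (at (h T))"
    using assms(6) by (auto simp: differentiable_def)
  \<comment> \<open>The chain rule needs \<open>C\<close> differentiable at \<open>?s (h t)\<close>,
    which \<open>s\<close> identifies with \<open>h T\<close>.\<close>
  then have CL: "((\<lambda>a. C (?s a)) has_derivative (\<lambda>u. C' (L u))) (at (h t))"
    using has_derivative_compose[OF L, of C C'] by (simp add: s)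
  have bl: "bounded_linear C'" "bounded_linear L"
    using C' L has_derivative_bounded_linear by blast+
  have "norm (gradient (\<lambda>a. C (?s a)) (h t)) = onorm (\<lambda>u. C' (L u))"
    using CL by (rule norm_gradient_eq_onorm)
  also have "\<dots> \<le> onorm C' * onorm L"
    using onorm_compose[OF bl] by (simp add: o_def)
  also have "\<dots> \<le> norm (gradient C (h T)) * ?P"
    using le by (simp add: norm_gradient_eq_onorm[OF C'] mult_left_mono onorm_pos_le bl)
  finally show ?thesis
    using CL by (auto simp: differentiable_def)
qed

end
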